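(* Let $f: A\to A$ be a twist map on the closed annulus $A=\mathbb{T}\times[0,1]$, and suppose that $f$ is non-wandering. Then $\rho(f_0)<\rho(f_1)$, where $\rho(f_0)$ and $\rho(f_1)$ are the rotation numbers of the restrictions of $f$ to the boundary circles $\mathbb{T}\times\{0\}$ and $\mathbb{T}\times\{1\}$, computed with respect to a common lift of $f$.
   Context: Let $\mathbb{T}=\mathbb{R}/\mathbb{Z}$, $A=\mathbb{T}\times[0,1]$ the closed annulus, $\tilde A=\mathbb{R}\times[0,1]$ its universal cover, and $\pi_1$ the projection to the first coordinate (from $A$ to $\mathbb{T}$, or from $\tilde A$ to $\mathbb{R}$). Twist map: an orientation-preserving homeomorphism $f:A\to A$, $(x,y)\mapsto(x_1,y_1)$, that preserves each boundary component ($y_1=0$ if $y=0$, and $y_1=1$ if $y=1$) and satisfies the (positive) twist condition: for each $x$, the map $y\mapsto x_1(x,y)$ is strictly increasing on $[0,1]$. The monotonicity is understood on the universal cover: for a lift $\tilde f:\tilde A\to\tilde A$ of $f$ and each $\tilde x\in\mathbb{R}$, the real-valued function $y\mapsto\pi_1(\tilde f(\tilde x,y))$ is strictly increasing. Boundary rotation numbers: fix a lift $\tilde f:\tilde A\to\tilde A$ of $f$; lifts are unique up to integer translations $(x,y)\mapsto(x+k,y)$, $k\in\mathbb{Z}$, and by convention $\tilde f$ is chosen so that $\rho(\tilde f_0)\in[0,1)$. For $i=0,1$ set $f_i(x)=\pi_1(f(x,i))$ and $\tilde f_i(\tilde x)=\pi_1(\tilde f(\tilde x,i))$. The rotation number is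 $\rho(f_i):=\rho(\tilde f_i)=\lim_{n\to\infty}\frac{\tilde f_i^n(\tilde x)-\tilde x}{n}\in\mathbb{R}$, which exists and is independent of $\tilde x\in\mathbb{R}$. The same lift $\tilde f$ is used for $i=0$ and $i=1$; changing the lift shifts both numbers by the same integer. Non-wandering: a point $z\in A$ is wandering if it has an open neighborhood $U$ with $f^n(U)\cap U=\emptyset$ for every $n\ge1$; $f$ is non-wandering if no point of $A$ is wandering. *)

theory Defs
  imports "HOL-Complex_Analysis.Complex_Analysis"
begin

text \<open>The circle \<open>\<real>/\<int>\<close> is modelled as the unit circle in the complex plane,
  the class of \<open>x\<close> being \<open>cis (2 * pi * x)\<close>.\<close>

definition circle :: "complex set" where
  "circle = sphere 0 1"

definition annulus :: "(complex \<times> real) set" where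
  "annulus = circle \<times> {0..1}"

definition strip :: "(real \<times> real) set" where
  "strip = UNIV \<times> {0..1}"

definition cover :: "real \<times> real \<Rightarrow> complex \<times> real" where
  "cover p = (cis (2 * pi * fst p), snd p)"

definition is_lift :: "(complex \<times> real \<Rightarrow> complex \<times> real) \<Rightarrow> (real \<times> real \<Rightarrow> real \<times> real) \<Rightarrow> bool" where
  "is_lift f F \<longleftrightarrow> continuous_on strip F \<and> F ` strip \<subseteq> strip \<and>
     (\<forall>p\<in>strip. cover (F p) = f (cover p))"

text \<open>An orientation-preserving injective map of a planar region is one of local degree \<open>1\<close>: the
  image of a small positively oriented circle around an interior point winds once, positively,
  around the image of that point.\<close>

definition on_plane :: "(real \<times> real \<Rightarrow> real \<times> real) \<Rightarrow> complex \<Rightarrow> complex" where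
  "on_plane F z = Complex (fst (F (Re z, Im z))) (snd (F (Re z, Im z)))"

definition local_degree_one_on :: "complex set \<Rightarrow> (complex \<Rightarrow> complex) \<Rightarrow> bool" where
  "local_degree_one_on S h \<longleftrightarrow>
     (\<forall>z r. 0 < r \<and> cball z r \<subseteq> S \<longrightarrow> winding_number (h \<circ> circlepath z r) (h z) = 1)"

text \<open>The covering map is a local homeomorphism which carries the orientation of the strip to that
  of the annulus, so the orientation behaviour of \<open>f\<close> is read off from its lifts. A lift always
  exists (lemma \<open>ex_lift\<close> below), and two lifts differ by an integer translation.\<close>

definition orientation_preserving :: "(complex \<times> real \<Rightarrow> complex \<times> real) \<Rightarrow> bool" where
  "orientation_preserving f \<longleftrightarrow>
     (\<forall>F. is_lift f F \<longrightarrow> local_degree_one_on {z. 0 < Im z \<and> Im z < 1} (on_plane F))"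

definition twist_condition :: "(complex \<times> real \<Rightarrow> complex \<times> real) \<Rightarrow> bool" where
  "twist_condition f \<longleftrightarrow>
     (\<forall>F. is_lift f F \<longrightarrow> (\<forall>x. strict_mono_on {0..1} (\<lambda>y. fst (F (x, y)))))"

definition twist_map :: "(complex \<times> real \<Rightarrow> complex \<times> real) \<Rightarrow> bool" where
  "twist_map f \<longleftrightarrow>
     (\<exists>g. homeomorphism annulus annulus f g) \<and>
     orientation_preserving f \<and>
     (\<forall>u\<in>circle. snd (f (u, 0)) = 0 \<and> snd (f (u, 1)) = 1) \<and>
     twist_condition f"

definition boundary_map :: "(real \<times> real \<Rightarrow> real \<times> real) \<Rightarrow> real \<Rightarrow> real \<Rightarrow> real" where
  "boundary_map F i x = fst (F (x, i))"

definition rotation_number :: "(real \<Rightarrow> real) \<Rightarrow> real" where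
  "rotation_number h = (THE r. \<forall>x. (\<lambda>n. ((h ^^ n) x - x) / real n) \<longlonglongrightarrow> r)"

definition wandering :: "(complex \<times> real \<Rightarrow> complex \<times> real) \<Rightarrow> complex \<times> real \<Rightarrow> bool" where
  "wandering f z \<longleftrightarrow>
     (\<exists>U. openin (top_of_set annulus) U \<and> z \<in> U \<and> (\<forall>n\<ge>1. (f ^^ n) ` U \<inter> U = {}))"

definition non_wandering :: "(complex \<times> real \<Rightarrow> complex \<times> real) \<Rightarrow> bool" where
  "non_wandering f \<longleftrightarrow> (\<forall>z\<in>annulus. \<not> wandering f z)"

lemma ex_lift:
  assumes "continuous_on annulus f" and "f ` annulus \<subseteq> annulus"
  shows "\<exists>F. is_lift f F"
proof -
  have cov: "cover p \<in> annulus" if "p \<in> strip" for p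
    using that by (auto simp: cover_def annulus_def circle_def strip_def)
  have "continuous_on strip cover"
    unfolding cover_def cis_conv_exp by (intro continuous_intros)
  then have fc: "continuous_on strip (\<lambda>p. f (cover p))"
    by (rule continuous_on_compose2[OF assms(1)]) (use cov in auto)
  have img: "f (cover p) \<in> annulus" if "p \<in> strip" for p
    using assms(2) cov[OF that] by auto
  have nrm: "norm (fst (f (cover p))) = 1" if "p \<in> strip" for p
    using img[OF that] by (auto simp: annulus_def circle_def)
  have contr: "contractible strip"
    unfolding strip_def by (intro convex_imp_contractible convex_Times) auto
  have c1: "continuous_on strip (\<lambda>p. fst (f (cover p)))"
    by (intro continuous_intros fc)
  have nz: "fst (f (cover p)) \<noteq> 0" if "p \<in> strip" for p
    using nrm[OF that] by auto
  obtain h where h: "continuous_on strip h"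
    "\<And>p. p \<in> strip \<Longrightarrow> fst (f (cover p)) = exp (h p)"
    using continuous_logarithm_on_contractible[OF c1 contr nz] by blast
  have Re0: "Re (h p) = 0" if "p \<in> strip" for p
    using nrm[OF that] h(2)[OF that] by simp
  have "exp (h p) = cis (Im (h p))" if "p \<in> strip" for p
    by (simp add: exp_eq_polar Re0[OF that])
  then have cisIm: "cis (Im (h p)) = fst (f (cover p))" if "p \<in> strip" for p
    using h(2)[OF that] that by simp
  define F where "F p = (Im (h p) / (2 * pi), snd (f (cover p)))" for p
  have "continuous_on strip F"
    unfolding F_def by (intro continuous_intros h fc) auto
  moreover have "F ` strip \<subseteq> strip"
  proof
    fix q assume "q \<in> F ` strip"
    then obtain p where p: "p \<in> strip" "q = F p" by blast
    have "snd (f (cover p)) \<in> {0..1}"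
      using img[OF p(1)] unfolding annulus_def by (auto simp: mem_Times_iff)
    then show "q \<in> strip"
      unfolding strip_def by (simp add: p(2) F_def)
  qed
  moreover have "cover (F p) = f (cover p)" if "p \<in> strip" for p
    using cisIm[OF that] by (simp add: cover_def F_def)
  ultimately show ?thesis
    unfolding is_lift_def by blast
qed

end

theory Submission imports Defs begin

text \<open>
  Let \<open>h\<^sub>0 < h\<^sub>1\<close> be the boundary maps of the lift \<open>F\<close>, the inequality being the twist condition
  on the two ends of a fiber. Suppose the rotation number of \<open>h\<^sub>1\<close> did not exceed that of
  \<open>h\<^sub>0\<close>. By compactness \<open>h\<^sub>1 - h\<^sub>0\<close> is bounded below by a positive constant. Dirichlet
  approximation then forces both rotation numbers to be one rational \<open>p / q\<close>, so that there are \<open>a\<close>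
  with \<open>h\<^sub>0\<^sup>q a = a + p\<close> and \<open>b\<close> with \<open>h\<^sub>1\<^sup>q b = b + p\<close>, and one may take \<open>a < b < a + 1\<close>
  (\<open>common_periodic_orbits\<close>).

  Every vertical fiber is mapped between its boundary values, and \<open>h\<^sub>0\<close>, \<open>h\<^sub>1\<close> are increasing.
  Hence \<open>F\<^sup>q\<close> maps the rectangle \<open>[a, b] \<times> [0, 1]\<close> into its translate by \<open>p\<close>. The image touches
  the left side of that translate at the bottom corner only, because the twist is strict. In the annulus
  this is a compact set \<open>S\<close> with \<open>f\<^sup>q(S) \<subseteq> S\<close> and an open part of \<open>S\<close> outside \<open>f\<^sup>q(S)\<close>, to
  which no orbit of \<open>f\<^sup>q\<close> returns (\<open>trapped_annular_region\<close>). But the iterates of a non-wandering map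
  have returns to every non-empty open set (\<open>non_wandering_iterate_returns\<close>), a contradiction.

  That \<open>h\<^sub>0\<close> and \<open>h\<^sub>1\<close> are increasing needs the lift to have degree \<open>1\<close> rather than \<open>-1\<close>. This
  is the content of preserving orientation: the winding number of the image of a small circle is
  equal to the degree (\<open>winding_number_circle_eq_degree\<close>). Without it the statement fails,
  as \<open>(x, y) \<mapsto> (y - x, y)\<close> shows, whose square is the identity.
\<close>

section \<open>Rotation numbers of degree-one lifts\<close>

definition tends_to_rotation :: "(real \<Rightarrow> real) \<Rightarrow> real \<Rightarrow> bool" where
  "tends_to_rotation h r \<longleftrightarrow> (\<forall>x. (\<lambda>n. ((h ^^ n) x - x) / real n) \<longlonglongrightarrow> r)"

locale degree_one_lift =
  fixes h :: "real \<Rightarrow> real"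
  assumes cont: "continuous_on UNIV h"
    and mono: "strict_mono h"
    and shift: "h (x + 1) = h x + 1"
begin

lemma shift_int: "h (x + of_int k) = h x + of_int k"
proof -
  have nat: "h (x + real n) = h x + real n" for x n
  proof (induction n)
    case (Suc n)
    have "h (x + real (Suc n)) = h ((x + real n) + 1)" by (simp add: algebra_simps)
    also have "\<dots> = h x + real (Suc n)" using Suc shift[of "x + real n"] by simp
    finally show ?case .
  qed simp
  show ?thesis
  proof (cases k)
    case (nonneg n)
    then show ?thesis using nat[of x n] by simp
  next
    case (neg n)
    then show ?thesis using nat[of "x + of_int k" "Suc n"] by simp
  qed
qed

lemma le_iff: "h x \<le> h y \<longleftrightarrow> x \<le> y"
  using mono by (simp add: strict_mono_less_eq)

lemma less_iff: "h x < h y \<longleftrightarrow> x < y"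
  using mono by (simp add: strict_mono_less)

lemma iterate: "degree_one_lift (h ^^ n)"
proof (induction n)
  case 0
  show ?case by unfold_locales (auto simp: strict_mono_def)
next
  case (Suc n)
  then interpret I: degree_one_lift "h ^^ n" .
  show ?case
  proof
    show "continuous_on UNIV (h ^^ Suc n)"
      using continuous_on_compose2[OF cont I.cont] by (simp add: comp_def)
    show "strict_mono (h ^^ Suc n)"
      using mono I.mono by (simp add: strict_mono_def)
    show "(h ^^ Suc n) (x + 1) = (h ^^ Suc n) x + 1" for x
      by (simp add: I.shift shift)
  qed
qed

text \<open>\<open>x\<close> lies between two consecutive integer translates of \<open>y\<close>, and \<open>h\<close> keeps it between their
  images, which are the same translates of \<open>h y\<close>.\<close>

lemma displacement_variation: "\<bar>(h x - x) - (h y - y)\<bar> \<le> 1"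
proof -
  define k where "k = \<lfloor>x - y\<rfloor>"
  have k: "y + of_int k \<le> x" "x \<le> y + of_int (k + 1)"
    unfolding k_def by linarith+
  then have "h (y + of_int k) \<le> h x" "h x \<le> h (y + of_int (k + 1))"
    by (simp_all only: le_iff)
  then have "h y + of_int k \<le> h x" "h x \<le> h y + of_int (k + 1)"
    by (simp_all only: shift_int)
  with k show ?thesis by (simp add: abs_le_iff)
qed

lemma displacement_extrema:
  obtains u v where "\<And>x. h u - u \<le> h x - x" "\<And>x. h x - x \<le> h v - v"
proof -
  have c: "continuous_on {0..1} (\<lambda>x. h x - x)"
    by (intro continuous_intros continuous_on_subset[OF cont]) auto
  obtain u where u: "\<And>x. x \<in> {0..1} \<Longrightarrow> h u - u \<le> h x - x"
    using continuous_attains_inf[OF compact_Icc _ c] by force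
  obtain v where v: "\<And>x. x \<in> {0..1} \<Longrightarrow> h x - x \<le> h v - v"
    using continuous_attains_sup[OF compact_Icc _ c] by force
  have red: "h x - x = h (frac x) - frac x" for x
    using shift_int[of "frac x" "\<lfloor>x\<rfloor>"] by (simp add: frac_def)
  have "frac x \<in> {0..1}" for x :: real
    using frac_ge_0[of x] frac_lt_1[of x] by auto
  then show ?thesis
    using that[of u v] u v red by metis
qed

lemma displacement_multiple:
  "\<bar>(h ^^ (m * n)) 0 - real m * (h ^^ n) 0\<bar> \<le> real m"
proof (induction m)
  case (Suc m)
  interpret I: degree_one_lift "h ^^ n" by (rule iterate)
  have "(h ^^ (Suc m * n)) 0 = (h ^^ n) ((h ^^ (m * n)) 0)"
    by (simp add: funpow_add)
  then show ?case
    using Suc I.displacement_variation[of "(h ^^ (m * n)) 0" 0]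
    by (simp add: algebra_simps abs_le_iff)
qed simp

text \<open>The orbit of \<open>0\<close> over \<open>m * n\<close> steps can be counted as \<open>m\<close> blocks of length \<open>n\<close> or as \<open>n\<close>
  blocks of length \<open>m\<close>, with errors at most \<open>m\<close> and \<open>n\<close>. So the averages over \<open>m\<close> and
  \<open>n\<close> steps differ by at most \<open>1 / m + 1 / n\<close>, and the averages form a Cauchy sequence.\<close>

lemma rotation_exists: "\<exists>r. tends_to_rotation h r"
proof -
  define a where "a n = (h ^^ n) 0" for n
  have close: "\<bar>a n / real n - a m / real m\<bar> \<le> 1 / real n + 1 / real m"
    if "m > 0" "n > 0" for m n
  proof -
    have "\<bar>a (m * n) - real m * a n\<bar> \<le> real m" "\<bar>a (m * n) - real n * a m\<bar> \<le> real n"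
      using displacement_multiple[of m n] displacement_multiple[of n m]
      by (simp_all add: a_def mult.commute)
    then have "\<bar>real m * a n - real n * a m\<bar> \<le> real m + real n" by linarith
    then have "\<bar>real m * a n - real n * a m\<bar> / (real m * real n) \<le> (real m + real n) / (real m * real n)"
      using that by (intro divide_right_mono) auto
    moreover have "\<bar>real m * a n - real n * a m\<bar> / (real m * real n) = \<bar>a n / real n - a m / real m\<bar>"
    proof -
      have "a n / real n - a m / real m = (real m * a n - real n * a m) / (real m * real n)"
        using that by (simp add: field_simps)
      then show ?thesis using that by (simp add: abs_mult)
    qed
    moreover have "(real m + real n) / (real m * real n) = 1 / real n + 1 / real m"
      using that by (simp add: field_simps)
    ultimately show ?thesis by simp
  qed
  have "Cauchy (\<lambda>n. a n / real n)"
  proof (rule CauchyI)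
    fix e :: real assume "e > 0"
    then obtain M where M: "M > 0" "inverse (real M) < e / 2"
      using reals_Archimedean3[of "e/2"] by (metis half_gt_zero ex_inverse_of_nat_less)
    have "\<bar>a n / real n - a m / real m\<bar> < e" if "n \<ge> M" "m \<ge> M" for m n
    proof -
      have "1 / real n \<le> inverse (real M)" "1 / real m \<le> inverse (real M)"
        using that M(1) by (auto simp: field_simps)
      with close[of m n] that M show ?thesis by linarith
    qed
    then show "\<exists>M. \<forall>m\<ge>M. \<forall>n\<ge>M. norm (a m / real m - a n / real n) < e"
      by (metis real_norm_def)
  qed
  then obtain r where r: "(\<lambda>n. a n / real n) \<longlonglongrightarrow> r"
    using Cauchy_convergent_iff convergent_def by blast
  have "(\<lambda>n. ((h ^^ n) x - x) / real n) \<longlonglongrightarrow> r" for x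
  proof -
    have bound: "norm (((h ^^ n) x - x) / real n - a n / real n) \<le> 1 / real n" for n
    proof -
      interpret I: degree_one_lift "h ^^ n" by (rule iterate)
      have "\<bar>((h ^^ n) x - x) - a n\<bar> \<le> 1"
        using I.displacement_variation[of x 0] by (simp add: a_def)
      then have "\<bar>((h ^^ n) x - x) - a n\<bar> / real n \<le> 1 / real n"
        by (rule divide_right_mono) simp
      then show ?thesis by (simp flip: diff_divide_distrib)
    qed
    have "(\<lambda>n. ((h ^^ n) x - x) / real n - a n / real n) \<longlonglongrightarrow> 0"
      by (rule Lim_null_comparison[OF _ lim_1_over_n]) (use bound in auto)
    from tendsto_add[OF this r] show ?thesis by simp
  qed
  then show ?thesis unfolding tends_to_rotation_def by blast
qed

lemma rotation_number_limit: "tends_to_rotation h (rotation_number h)"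
proof -
  obtain r where r: "tends_to_rotation h r" using rotation_exists by blast
  have "rotation_number h = r"
    unfolding rotation_number_def
  proof (rule the_equality)
    show "\<forall>x. (\<lambda>n. ((h ^^ n) x - x) / real n) \<longlonglongrightarrow> r"
      using r by (simp add: tends_to_rotation_def)
    show "r' = r" if "\<forall>x. (\<lambda>n. ((h ^^ n) x - x) / real n) \<longlonglongrightarrow> r'" for r'
      using r that LIMSEQ_unique unfolding tends_to_rotation_def by blast
  qed
  with r show ?thesis by simp
qed

lemma rotation_subsequence:
  assumes "q > 0"
  shows "(\<lambda>m. ((h ^^ (q * m)) x - x) / real m) \<longlonglongrightarrow> real q * rotation_number h"
proof -
  have "(\<lambda>n. ((h ^^ n) x - x) / real n) \<longlonglongrightarrow> rotation_number h"
    using rotation_number_limit by (simp add: tends_to_rotation_def)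
  moreover have "strict_mono (\<lambda>m. q * m)"
    using assms by (simp add: strict_mono_def)
  ultimately have "(\<lambda>m. ((h ^^ (q * m)) x - x) / real (q * m)) \<longlonglongrightarrow> rotation_number h"
    using LIMSEQ_subseq_LIMSEQ[unfolded comp_def] by fast
  from tendsto_mult_left[OF this, of "real q"]
  have "(\<lambda>m. real q * (((h ^^ (q * m)) x - x) / real (q * m))) \<longlonglongrightarrow> real q * rotation_number h" .
  moreover have "real q * (((h ^^ (q * m)) x - x) / real (q * m)) = ((h ^^ (q * m)) x - x) / real m" for m
    using assms by simp
  ultimately show ?thesis by simp
qed

lemma rotation_ge:
  assumes "q > 0" and "\<And>m. (h ^^ (q * m)) x \<ge> x + real m * c"
  shows "real q * rotation_number h \<ge> c"
proof (rule tendsto_lowerbound[OF rotation_subsequence[OF assms(1), of x]])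
  show "\<forall>\<^sub>F m in sequentially. c \<le> ((h ^^ (q * m)) x - x) / real m"
    using eventually_gt_at_top[of 0]
  proof eventually_elim
    case (elim m)
    then show ?case using assms(2)[of m] by (simp add: field_simps)
  qed
qed simp

lemma rotation_le:
  assumes "q > 0" and "\<And>m. (h ^^ (q * m)) x \<le> x + real m * c"
  shows "real q * rotation_number h \<le> c"
proof (rule tendsto_upperbound[OF rotation_subsequence[OF assms(1), of x]])
  show "\<forall>\<^sub>F m in sequentially. ((h ^^ (q * m)) x - x) / real m \<le> c"
    using eventually_gt_at_top[of 0]
  proof eventually_elim
    case (elim m)
    then show ?case using assms(2)[of m] by (simp add: field_simps)
  qed
qed simp

lemma rotation_ge_if_advances:
  assumes "q > 0" and "\<And>x. (h ^^ q) x \<ge> x + c"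
  shows "real q * rotation_number h \<ge> c"
proof (rule rotation_ge[OF assms(1)])
  show "(h ^^ (q * m)) 0 \<ge> 0 + real m * c" for m
  proof (induction m)
    case (Suc m)
    then show ?case using assms(2)[of "(h ^^ (q * m)) 0"]
      by (simp add: funpow_add algebra_simps)
  qed simp
qed

lemma rotation_le_if_advances:
  assumes "q > 0" and "\<And>x. (h ^^ q) x \<le> x + c"
  shows "real q * rotation_number h \<le> c"
proof (rule rotation_le[OF assms(1)])
  show "(h ^^ (q * m)) 0 \<le> 0 + real m * c" for m
  proof (induction m)
    case (Suc m)
    then show ?case using assms(2)[of "(h ^^ (q * m)) 0"]
      by (simp add: funpow_add algebra_simps)
  qed simp
qed

text \<open>For an integer advance a single point suffices, since \<open>h ^^ q\<close> commutes with integer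
  translations and so the advance repeats along the orbit.\<close>

lemma rotation_ge_if_point_advances:
  assumes "q > 0" and "(h ^^ q) x \<ge> x + of_int p"
  shows "real q * rotation_number h \<ge> of_int p"
proof (rule rotation_ge[OF assms(1)])
  interpret I: degree_one_lift "h ^^ q" by (rule iterate)
  show "(h ^^ (q * m)) x \<ge> x + real m * of_int p" for m
  proof (induction m)
    case (Suc m)
    have "(h ^^ q) (x + of_int (int m * p)) \<le> (h ^^ q) ((h ^^ (q * m)) x)"
      using Suc by (simp add: I.le_iff)
    then show ?case using assms(2)
      by (simp only: I.shift_int) (simp add: funpow_add algebra_simps)
  qed simp
qed

lemma rotation_le_if_point_advances:
  assumes "q > 0" and "(h ^^ q) x \<le> x + of_int p"
  shows "real q * rotation_number h \<le> of_int p"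
proof (rule rotation_le[OF assms(1)])
  interpret I: degree_one_lift "h ^^ q" by (rule iterate)
  show "(h ^^ (q * m)) x \<le> x + real m * of_int p" for m
  proof (induction m)
    case (Suc m)
    have "(h ^^ q) ((h ^^ (q * m)) x) \<le> (h ^^ q) (x + of_int (int m * p))"
      using Suc by (simp add: I.le_iff)
    then show ?case using assms(2)
      by (simp only: I.shift_int) (simp add: funpow_add algebra_simps)
  qed simp
qed

text \<open>If \<open>h ^^ q - p\<close> had no fixed point, its displacement would be bounded away from \<open>0\<close> on one
  side by periodicity and compactness, and its rotation number would not be \<open>0\<close>.\<close>

lemma periodic_point_if_rational:
  assumes "q > 0" and "real q * rotation_number h = of_int p"
  shows "\<exists>x. (h ^^ q) x = x + of_int p"
proof -
  interpret I: degree_one_lift "h ^^ q" by (rule iterate)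
  obtain u v where u: "\<And>x. (h ^^ q) u - u \<le> (h ^^ q) x - x"
    and v: "\<And>x. (h ^^ q) x - x \<le> (h ^^ q) v - v"
    using I.displacement_extrema by blast
  have "(h ^^ q) u - u \<le> of_int p"
    using rotation_ge_if_advances[of q "(h ^^ q) u - u"] u assms by (simp add: algebra_simps)
  moreover have "(h ^^ q) v - v \<ge> of_int p"
    using rotation_le_if_advances[of q "(h ^^ q) v - v"] v assms by (simp add: algebra_simps)
  moreover have "connected (range (\<lambda>x. (h ^^ q) x - x))"
    by (intro connected_continuous_image continuous_intros I.cont) auto
  ultimately have "of_int p \<in> range (\<lambda>x. (h ^^ q) x - x)"
    using connectedD_interval[of "range (\<lambda>x. (h ^^ q) x - x)"] by blast
  then obtain x where "of_int p = (h ^^ q) x - x" by blast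
  then show ?thesis by (intro exI[of _ x]) simp
qed

end

text \<open>Strict pointwise inequality of two lifts separates their rotation numbers unless both equal
  the same rational number. A uniform gap \<open>e\<close> separates the lifts. Take \<open>p / q\<close> with
  \<open>q * rotation_number h\<close> within \<open>e\<close> of \<open>p\<close>. Some point then moves under \<open>h ^^ q\<close> by more than
  \<open>p - e\<close>, hence by at least \<open>p\<close> under \<open>k ^^ q\<close>; and since \<open>k\<close> is assumed to rotate no faster,
  some point moves under \<open>k ^^ q\<close> by less than \<open>p + e\<close>, hence by at most \<open>p\<close> under \<open>h ^^ q\<close>.
  This squeezes both rotation numbers to \<open>p / q\<close>, and periodic points follow. The gap
  also prevents them from being congruent modulo \<open>1\<close>, so \<open>b\<close> can be moved strictly between \<open>a\<close> and
  \<open>a + 1\<close>.\<close>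

lemma common_periodic_orbits:
  assumes "degree_one_lift h" "degree_one_lift k"
    and less: "\<And>x. h x < k x"
    and rot: "rotation_number k \<le> rotation_number h"
  obtains q p a b where "q > 0" "(h ^^ q) a = a + of_int p" "(k ^^ q) b = b + of_int p"
    "a < b" "b < a + 1"
proof -
  interpret H: degree_one_lift h by fact
  interpret K: degree_one_lift k by fact
  let ?r = "rotation_number h" and ?s = "rotation_number k"
  obtain e where e: "e > 0" "\<And>x. h x + e \<le> k x"
  proof -
    have c: "continuous_on {0..1} (\<lambda>x. k x - h x)"
      by (intro continuous_intros continuous_on_subset[OF H.cont]
            continuous_on_subset[OF K.cont]) auto
    obtain u where u: "\<And>x. x \<in> {0..1} \<Longrightarrow> k u - h u \<le> k x - h x"
      using continuous_attains_inf[OF compact_Icc _ c] by force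
    have "k u - h u \<le> k x - h x" for x
    proof -
      have "k x - h x = k (frac x) - h (frac x)"
        using H.shift_int[of "frac x" "\<lfloor>x\<rfloor>"] K.shift_int[of "frac x" "\<lfloor>x\<rfloor>"]
        by (simp add: frac_def)
      then show ?thesis using u[of "frac x"] frac_ge_0[of x] frac_lt_1[of x] by simp
    qed
    then show ?thesis using that[of "k u - h u"] less[of u] by (simp add: algebra_simps)
  qed
  have le: "(h ^^ n) x \<le> (k ^^ n) x" for n x
  proof (induction n)
    case (Suc n)
    have "h ((h ^^ n) x) \<le> h ((k ^^ n) x)" using Suc by (simp add: H.le_iff)
    with less[of "(k ^^ n) x"] show ?case by simp
  qed simp
  have gap: "(h ^^ q) x + e \<le> (k ^^ q) x" if q: "q > 0" for q x
  proof -
    obtain n where n: "q = Suc n" using q gr0_implies_Suc by blast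
    have "h ((h ^^ n) x) \<le> h ((k ^^ n) x)" using le[of n x] by (simp add: H.le_iff)
    with e(2)[of "(k ^^ n) x"] show ?thesis by (simp add: n)
  qed
  obtain N :: nat where N: "N > 0" "1 / real N < e"
    using ex_inverse_of_nat_less[OF e(1)] by (auto simp: inverse_eq_divide)
  obtain p q' where pq': "0 < q'" "\<bar>of_int q' * ?r - of_int p\<bar> < 1 / real N"
    using Dirichlet_approx[OF N(1)] by metis
  define q where "q = nat q'"
  have q: "q > 0" "\<bar>real q * ?r - of_int p\<bar> < e"
    using pq' N(2) by (auto simp: q_def)
  have qs: "real q * ?s \<le> real q * ?r" using rot q(1) by simp
  have upper: "real q * ?r \<le> of_int p"
  proof (rule ccontr)
    assume "\<not> real q * ?r \<le> of_int p"
    have "\<exists>x. (k ^^ q) x < x + (of_int p + e)"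
    proof (rule ccontr)
      assume "\<not> ?thesis"
      then have "real q * ?s \<ge> of_int p + e"
        using K.rotation_ge_if_advances[OF q(1), of "of_int p + e"] by (meson not_less)
      with q(2) qs show False by linarith
    qed
    then obtain x where "(k ^^ q) x < x + (of_int p + e)" by blast
    with gap[OF q(1), of x] have "(h ^^ q) x \<le> x + of_int p" by linarith
    from H.rotation_le_if_point_advances[OF q(1) this] \<open>\<not> real q * ?r \<le> of_int p\<close>
    show False by simp
  qed
  have "\<exists>x. (h ^^ q) x > x + (of_int p - e)"
  proof (rule ccontr)
    assume "\<not> ?thesis"
    then have "real q * ?r \<le> of_int p - e"
      using H.rotation_le_if_advances[OF q(1), of "of_int p - e"] by (meson not_less)
    with q(2) show False by linarith
  qed
  then obtain x where "(h ^^ q) x > x + (of_int p - e)" by blast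
  with gap[OF q(1), of x] have "(k ^^ q) x \<ge> x + of_int p" by linarith
  from K.rotation_ge_if_point_advances[OF q(1) this] upper qs
  have eq: "real q * ?r = of_int p" "real q * ?s = of_int p" by linarith+
  obtain a where a: "(h ^^ q) a = a + of_int p"
    using H.periodic_point_if_rational[OF q(1) eq(1)] by blast
  obtain c where c: "(k ^^ q) c = c + of_int p"
    using K.periodic_point_if_rational[OF q(1) eq(2)] by blast
  interpret Kq: degree_one_lift "k ^^ q" by (rule K.iterate)
  define b where "b = c - of_int \<lfloor>c - a\<rfloor>"
  have b: "(k ^^ q) b = b + of_int p"
    using Kq.shift_int[of c "- \<lfloor>c - a\<rfloor>"] c by (simp add: b_def)
  have "a \<le> b" "b < a + 1" unfolding b_def by linarith+
  moreover have "a \<noteq> b" using a b gap[OF q(1), of a] e(1) by auto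
  ultimately show ?thesis using that[OF q(1) a b] by simp
qed

section \<open>Lifts of annulus homeomorphisms\<close>

lemma cover_eq_iff:
  "cover p = cover q \<longleftrightarrow> (\<exists>k::int. p = q + (of_int k, 0))"
proof -
  have "cis (2 * pi * x) = cis (2 * pi * y) \<longleftrightarrow> (\<exists>k::int. x = y + of_int k)" for x y
  proof -
    have "cis (2 * pi * x) = cis (2 * pi * y) \<longleftrightarrow> (\<exists>k::int. 2 * pi * x = 2 * pi * y + 2 * pi * k)"
      using sin_cos_eq_iff[of "2 * pi * x" "2 * pi * y"] by (auto simp: complex_eq_iff)
    also have "\<dots> \<longleftrightarrow> (\<exists>k::int. x = y + of_int k)"
      by (simp flip: distrib_left)
    finally show ?thesis .
  qed
  then show ?thesis by (cases p; cases q) (auto simp: cover_def)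
qed

lemma cover_in_annulus: "p \<in> strip \<Longrightarrow> cover p \<in> annulus"
  by (auto simp: cover_def annulus_def circle_def strip_def)

lemma annulus_cover:
  assumes "u \<in> annulus"
  obtains p where "p \<in> strip" "cover p = u" "a \<le> fst p" "fst p < a + 1"
proof -
  have n: "norm (fst u) = 1" using assms by (auto simp: annulus_def circle_def)
  define t where "t = Arg (fst u) / (2 * pi)"
  define p where "p = (t - of_int \<lfloor>t - a\<rfloor>, snd u)"
  have "fst u \<noteq> 0" using n by auto
  then have "cover (t, snd u) = u"
    using n cis_Arg[of "fst u"] by (simp add: cover_def t_def sgn_eq prod_eq_iff)
  moreover have "cover (t, snd u) = cover p"
    unfolding cover_eq_iff by (intro exI[of _ "\<lfloor>t - a\<rfloor>"]) (simp add: p_def)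
  moreover have "p \<in> strip" using assms by (auto simp: p_def strip_def annulus_def)
  moreover have "a \<le> fst p" "fst p < a + 1" unfolding p_def fst_conv by linarith+
  ultimately show ?thesis using that by metis
qed

lemma continuous_on_cover: "continuous_on S cover"
  unfolding cover_def cis_conv_exp by (intro continuous_intros)

lemma convex_strip: "convex strip"
  unfolding strip_def by (intro convex_Times) auto

lemma strip_translate: "p \<in> strip \<Longrightarrow> p + (x, 0) \<in> strip"
  by (auto simp: strip_def)

text \<open>The difference of the first coordinates is continuous and integer-valued on a connected set.\<close>

lemma lifts_differ_by_deck_translation:
  assumes P: "continuous_on strip P" and Q: "continuous_on strip Q"
    and eq: "\<And>p. p \<in> strip \<Longrightarrow> cover (P p) = cover (Q p)"
  shows "\<exists>k::int. \<forall>p\<in>strip. P p = Q p + (of_int k, 0)"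
proof -
  define u where "u p = fst (P p) - fst (Q p)" for p
  have ex: "\<exists>k::int. P p = Q p + (of_int k, 0) \<and> u p = of_int k" if p: "p \<in> strip" for p
    using eq[OF p] by (auto simp: cover_eq_iff u_def)
  have "u constant_on strip"
  proof (rule continuous_discrete_range_constant)
    show "connected strip" by (rule convex_connected[OF convex_strip])
    show "continuous_on strip u" unfolding u_def by (intro continuous_intros P Q)
    fix p assume p: "p \<in> strip"
    show "\<exists>e>0. \<forall>q. q \<in> strip \<and> u q \<noteq> u p \<longrightarrow> e \<le> norm (u q - u p)"
    proof (intro exI[of _ 1] conjI allI impI)
      fix q assume q: "q \<in> strip \<and> u q \<noteq> u p"
      obtain i j :: int where "u q = of_int i" "u p = of_int j"
        using ex[OF p] ex[of q] q by blast
      then show "1 \<le> norm (u q - u p)" using q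
        by (simp flip: of_int_diff add: abs_if)
    qed simp
  qed
  then obtain c where c: "\<And>p. p \<in> strip \<Longrightarrow> u p = c" by (auto simp: constant_on_def)
  have "(0,0) \<in> strip" by (simp add: strip_def)
  then obtain k :: int where "c = of_int k" using ex c by metis
  with c ex show ?thesis by (metis of_int_eq_iff)
qed

lemma lift_degree:
  assumes "is_lift f F"
  obtains d :: int where
    "\<And>p n. p \<in> strip \<Longrightarrow> F (p + (of_int n, 0)) = F p + (of_int (n * d), 0)"
proof -
  have F: "continuous_on strip F" "\<And>p. p \<in> strip \<Longrightarrow> cover (F p) = f (cover p)"
    using assms by (auto simp: is_lift_def)
  have "\<exists>d::int. \<forall>p\<in>strip. F (p + (1, 0)) = F p + (of_int d, 0)"
  proof (rule lifts_differ_by_deck_translation[OF _ F(1)])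
    show "continuous_on strip (\<lambda>p. F (p + (1, 0)))"
      by (rule continuous_on_compose2[OF F(1)]) (intro continuous_intros, use strip_translate in blast)
    show "cover (F (p + (1, 0))) = cover (F p)" if "p \<in> strip" for p
    proof -
      have "cover (p + (1, 0)) = cover p"
        unfolding cover_eq_iff by (intro exI[of _ 1]) simp
      then show ?thesis using that by (simp add: F(2) strip_translate)
    qed
  qed
  then obtain d :: int where d: "\<And>p. p \<in> strip \<Longrightarrow> F (p + (1, 0)) = F p + (of_int d, 0)"
    by blast
  have nat: "F (p + (real n, 0)) = F p + (real n * of_int d, 0)" if "p \<in> strip" for p n
  proof (induction n)
    case (Suc n)
    have "F (p + (real (Suc n), 0)) = F ((p + (real n, 0)) + (1, 0))"
      by (simp add: ac_simps)
    also have "\<dots> = F (p + (real n, 0)) + (of_int d, 0)"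
      by (rule d[OF strip_translate[OF that]])
    also have "\<dots> = F p + (real (Suc n) * of_int d, 0)"
      unfolding Suc by (simp add: prod_eq_iff algebra_simps)
    finally show ?case .
  qed (simp add: zero_prod_def[symmetric])
  have "F (p + (of_int n, 0)) = F p + (of_int (n * d), 0)" if "p \<in> strip" for p n
  proof (cases n)
    case (nonneg m)
    then show ?thesis using nat[OF that, of m] by simp
  next
    case (neg m)
    have "F ((p + (of_int n, 0)) + (real (Suc m), 0))
        = F (p + (of_int n, 0)) + (real (Suc m) * of_int d, 0)"
      by (rule nat[OF strip_translate[OF that]])
    moreover have "(p + (of_int n, 0)) + (real (Suc m), 0) = p"
      using neg by (simp add: add.assoc prod_eq_iff)
    ultimately have "F (p + (of_int n, 0)) = F p - (real (Suc m) * of_int d, 0)"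
      by (simp only: eq_diff_eq)
    also have "real (Suc m) = - of_int n"
      unfolding neg by simp
    finally show ?thesis by (simp add: prod_eq_iff)
  qed
  then show ?thesis using that by blast
qed

text \<open>Lifting the inverse as well gives \<open>G\<close> with \<open>G \<circ> F\<close> a deck translation. This makes \<open>F\<close>
  injective, and shows that the degrees of \<open>F\<close> and \<open>G\<close> are integers with product \<open>1\<close>.\<close>

lemma homeomorphism_lift:
  assumes hom: "homeomorphism annulus annulus f g" and lift: "is_lift f F"
  obtains d :: int where "d = 1 \<or> d = -1" "inj_on F strip"
    "\<And>p n. p \<in> strip \<Longrightarrow> F (p + (of_int n, 0)) = F p + (of_int (n * d), 0)"
proof -
  have g: "continuous_on annulus g" "g ` annulus \<subseteq> annulus"
    "\<And>u. u \<in> annulus \<Longrightarrow> g (f u) = u"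
    using hom by (auto simp: homeomorphism_def)
  obtain G where G: "is_lift g G" using ex_lift[OF g(1,2)] by blast
  obtain d :: int where d:
    "\<And>p n. p \<in> strip \<Longrightarrow> F (p + (of_int n, 0)) = F p + (of_int (n * d), 0)"
    using lift_degree[OF lift] by blast
  obtain e :: int where e:
    "\<And>p n. p \<in> strip \<Longrightarrow> G (p + (of_int n, 0)) = G p + (of_int (n * e), 0)"
    using lift_degree[OF G] by blast
  have Fs: "F p \<in> strip" if "p \<in> strip" for p
    using lift that by (auto simp: is_lift_def)
  have "\<exists>k::int. \<forall>p\<in>strip. G (F p) = p + (of_int k, 0)"
  proof (rule lifts_differ_by_deck_translation)
    show "continuous_on strip (\<lambda>p. G (F p))"
      by (rule continuous_on_compose2[of strip G]) (use G lift in \<open>auto simp: is_lift_def\<close>)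
    show "cover (G (F p)) = cover p" if "p \<in> strip" for p
    proof -
      have "cover (G (F p)) = g (f (cover p))"
        using G lift that Fs[OF that] by (simp add: is_lift_def)
      then show ?thesis using g(3) cover_in_annulus[OF that] by simp
    qed
  qed (intro continuous_intros)
  then obtain k :: int where k: "\<And>p. p \<in> strip \<Longrightarrow> G (F p) = p + (of_int k, 0)" by blast
  have "inj_on F strip"
    by (rule inj_onI) (metis k add_right_cancel)
  moreover have "d * e = 1"
  proof -
    have z: "(0, 0) \<in> strip" by (simp add: strip_def)
    have "(0, 0) + (1, 0) + (of_int k, 0) = G (F ((0, 0) + (of_int 1, 0)))"
      using k[OF strip_translate[OF z, of 1]] by simp
    also have "\<dots> = (0, 0) + (of_int k, 0) + (of_int (d * e), 0)"
      using d[OF z, of 1] e[OF Fs[OF z], of d] k[OF z] by simp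
    finally have "of_int (d * e) = (1::real)" by simp
    then show ?thesis by (simp only: of_int_eq_1_iff)
  qed
  then have "d = 1 \<or> d = -1" by (auto simp: zmult_eq_1_iff)
  ultimately show ?thesis using that d by blast
qed

section \<open>Orientation and degree\<close>

text \<open>A loop of pairs of distinct points is mapped by an injective \<open>F\<close> to a loop in the punctured
  plane. Its winding number is unchanged when the pairs move, so it can be computed on pairs for
  which \<open>F\<close> is understood.\<close>

definition difference_map :: "(real \<times> real \<Rightarrow> real \<times> real) \<Rightarrow> real \<times> real \<Rightarrow> real \<times> real \<Rightarrow> complex" where
  "difference_map F p q = Complex (fst (F p) - fst (F q)) (snd (F p) - snd (F q))"

text \<open>Both points of the pair move along straight segments, which stay in the convex strip. The
  acute angle between initial and final displacement keeps the two points apart on the way.\<close>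

lemma homotopic_difference_loops:
  assumes F: "continuous_on strip F" "inj_on F strip"
    and cont: "continuous_on {0..1} p0" "continuous_on {0..1} q0"
      "continuous_on {0..1} p1" "continuous_on {0..1} q1"
    and loop: "p0 0 = p0 1" "q0 0 = q0 1" "p1 0 = p1 1" "q1 0 = q1 1"
    and strip: "\<And>t. t \<in> {0..1} \<Longrightarrow> p0 t \<in> strip \<and> q0 t \<in> strip \<and> p1 t \<in> strip \<and> q1 t \<in> strip"
    and acute: "\<And>t. t \<in> {0..1} \<Longrightarrow> (p0 t - q0 t) \<bullet> (p1 t - q1 t) > 0"
  shows "homotopic_loops (- {0}) (\<lambda>t. difference_map F (p0 t) (q0 t)) (\<lambda>t. difference_map F (p1 t) (q1 t))"
proof -
  define P where "P z = (1 - fst z) *\<^sub>R p0 (snd z) + fst z *\<^sub>R p1 (snd z)" for z :: "real \<times> real"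
  define Q where "Q z = (1 - fst z) *\<^sub>R q0 (snd z) + fst z *\<^sub>R q1 (snd z)" for z :: "real \<times> real"
  let ?I = "{0..1::real} \<times> {0..1::real}"
  have PQ: "P z \<in> strip" "Q z \<in> strip" if "z \<in> ?I" for z
  proof -
    show "P z \<in> strip"
      unfolding P_def using that strip by (intro convexD[OF convex_strip]) auto
    show "Q z \<in> strip"
      unfolding Q_def using that strip by (intro convexD[OF convex_strip]) auto
  qed
  have ne: "P z \<noteq> Q z" if z: "z \<in> ?I" for z
  proof
    assume eq: "P z = Q z"
    define s u v where "s = fst z" and "u = p0 (snd z) - q0 (snd z)" and "v = p1 (snd z) - q1 (snd z)"
    have "(1 - s) *\<^sub>R u + s *\<^sub>R v = 0"
      using eq by (simp add: P_def Q_def s_def u_def v_def algebra_simps)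
    then have "u \<bullet> ((1 - s) *\<^sub>R u + s *\<^sub>R v) = 0" by simp
    then have "(1 - s) * (u \<bullet> u) + s * (u \<bullet> v) = 0" by (simp add: inner_add_right)
    moreover have "u \<bullet> v > 0" using acute[of "snd z"] z by (auto simp: u_def v_def)
    moreover then have "u \<bullet> u > 0" by auto
    moreover have "0 \<le> s" "s \<le> 1" using z by (auto simp: s_def)
    ultimately show False
      by (cases "s = 0") (auto simp: add_nonneg_eq_0_iff)
  qed
  have cP: "continuous_on ?I P" "continuous_on ?I Q"
    unfolding P_def Q_def
    by (intro continuous_intros continuous_on_compose2[OF cont(1)] continuous_on_compose2[OF cont(2)]
      continuous_on_compose2[OF cont(3)] continuous_on_compose2[OF cont(4)]; force)+
  have cFP: "continuous_on ?I (\<lambda>z. F (P z))" "continuous_on ?I (\<lambda>z. F (Q z))"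
    using PQ by (auto intro!: continuous_on_compose2[OF F(1) cP(1)] continuous_on_compose2[OF F(1) cP(2)])
  show ?thesis
    unfolding homotopic_loops
  proof (intro exI[of _ "\<lambda>z. difference_map F (P z) (Q z)"] conjI ballI)
    show "continuous_on ?I (\<lambda>z. difference_map F (P z) (Q z))"
      unfolding difference_map_def Complex_eq by (intro continuous_intros cFP)
    show "(\<lambda>z. difference_map F (P z) (Q z)) \<in> ?I \<rightarrow> - {0}"
    proof
      fix z assume z: "z \<in> ?I"
      then have "F (P z) \<noteq> F (Q z)" using PQ ne F(2) by (meson inj_onD)
      then show "difference_map F (P z) (Q z) \<in> - {0}"
        by (auto simp: difference_map_def complex_eq_iff prod_eq_iff)
    qed
  qed (auto simp: P_def Q_def pathstart_def pathfinish_def loop)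
qed

text \<open>A small circle of pairs can be deformed into a loop of pairs of two kinds. Either
  the base point lies on a boundary line, so that the difference of the images stays in a closed
  half plane, or the two points are integer translates of each other, so that the difference is exactly
  \<open>d\<close> or \<open>- d\<close>. Such a loop is linearly homotopic to the unit circle, reflected in the imaginary
  axis when \<open>d = - 1\<close>. This is where orientation is converted into the sign of the degree.\<close>

lemma winding_number_circle_eq_degree:
  assumes F: "continuous_on strip F" "inj_on F strip" "F ` strip \<subseteq> strip"
    and bdry: "\<And>x. snd (F (x, 0)) = 0" "\<And>x. snd (F (x, 1)) = 1"
    and deg: "\<And>p n. p \<in> strip \<Longrightarrow> F (p + (of_int n, 0)) = F p + (of_int (n * d), 0)"
    and d: "d = 1 \<or> d = (-1::int)"
  defines "z \<equiv> Complex 0 (1/2)"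
  shows "winding_number (on_plane F \<circ> circlepath z (1/4)) (on_plane F z) = of_int d"
proof -
  define C S where "C t = cos (2 * pi * t)" and "S t = sin (2 * pi * t)" for t :: real
  define c where "c t = max 0 (min 1 (1/2 - S t))" for t
  define e where "e t = max (-1) (min 1 (2 * C t))" for t
  have CS: "continuous_on A C" "continuous_on A S" for A
    unfolding C_def S_def by (intro continuous_intros)+
  have sq: "(C t)\<^sup>2 + (S t)\<^sup>2 = 1" for t by (simp add: C_def S_def)
  have S1: "-1 \<le> S t" "S t \<le> 1" for t by (auto simp: S_def)
  have cont_ce: "continuous_on A c" "continuous_on A e" for A
    unfolding c_def e_def by (intro continuous_intros CS)+
  have per: "C 0 = C 1" "S 0 = S 1" by (simp_all add: C_def S_def)
  \<comment> \<open>The base point \<open>q1\<close> is at the bottom for \<open>S \<ge> 1/2\<close>, at the top for \<open>S \<le> -1/2\<close>,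
    and travels between them while \<open>p1\<close> keeps the same height one unit to its right or left:
    \<open>\<bar>S\<bar> \<le> 1/2\<close> makes \<open>\<bar>C\<bar>\<close> so large that \<open>e\<close> is \<open>1\<close> or \<open>-1\<close>.\<close>
  define p0 q0 p1 q1 where "p0 t = (C t / 4, 1/2 + S t / 4)" and "q0 t = (0::real, 1/2::real)"
    and "p1 t = (e t, S t + 2 * c t - 1/2)" and "q1 t = (0::real, c t)" for t
  have p1s: "p1 t \<in> strip" "q1 t \<in> strip" for t
    using S1[of t] by (auto simp: strip_def p1_def q1_def c_def max_def min_def)
  have hom1: "homotopic_loops (- {0}) (\<lambda>t. difference_map F (p0 t) (q0 t)) (\<lambda>t. difference_map F (p1 t) (q1 t))"
  proof (rule homotopic_difference_loops[OF F(1,2)])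
    show "p0 t \<in> strip \<and> q0 t \<in> strip \<and> p1 t \<in> strip \<and> q1 t \<in> strip" for t
      using S1[of t] p1s by (auto simp: strip_def p0_def q0_def)
    show "(p0 t - q0 t) \<bullet> (p1 t - q1 t) > 0" for t
    proof -
      have "C t * e t \<ge> 0" "C t \<noteq> 0 \<Longrightarrow> C t * e t > 0"
        by (auto simp: e_def max_def min_def zero_le_mult_iff zero_less_mult_iff)
      moreover have "S t * (S t + c t - 1/2) \<ge> 0"
        using S1[of t] by (auto simp: c_def max_def min_def zero_le_mult_iff)
      moreover have "S t * (S t + c t - 1/2) > 0" if "C t = 0"
      proof -
        have "S t = 1 \<or> S t = -1" using sq[of t] that by (simp add: power2_eq_1_iff)
        then show ?thesis by (auto simp: c_def)
      qed
      ultimately have "C t * e t + S t * (S t + c t - 1/2) > 0"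
        by (cases "C t = 0") (auto intro: add_nonneg_pos add_pos_nonneg)
      moreover have "(p0 t - q0 t) \<bullet> (p1 t - q1 t) = (C t * e t + S t * (S t + c t - 1/2)) / 4"
        by (simp add: p0_def q0_def p1_def q1_def field_simps)
      ultimately show ?thesis by simp
    qed
  qed (auto simp: p0_def q0_def p1_def q1_def per c_def e_def intro!: continuous_intros CS)
  have hom2: "homotopic_loops (- {0}) (\<lambda>t. difference_map F (p1 t) (q1 t)) (\<lambda>t. Complex (of_int d * C t) (S t))"
  proof (rule homotopic_loops_linear)
    show "path (\<lambda>t. difference_map F (p1 t) (q1 t))" "pathfinish (\<lambda>t. difference_map F (p1 t) (q1 t)) = pathstart (\<lambda>t. difference_map F (p1 t) (q1 t))"
      using homotopic_loops_imp_path[OF hom1] homotopic_loops_imp_loop[OF hom1] by auto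
    show "path (\<lambda>t. Complex (of_int d * C t) (S t))"
      unfolding path_def Complex_eq by (intro continuous_intros CS)
    show "pathfinish (\<lambda>t. Complex (of_int d * C t) (S t)) = pathstart (\<lambda>t. Complex (of_int d * C t) (S t))"
      by (simp add: pathstart_def pathfinish_def per)
    fix t :: real assume "t \<in> {0..1}"
    let ?w = "difference_map F (p1 t) (q1 t)"
    have wne: "?w \<noteq> 0"
      using homotopic_loops_imp_subset[OF hom1] \<open>t \<in> {0..1}\<close> by (auto simp: path_image_def)
    show "closed_segment ?w (Complex (of_int d * C t) (S t)) \<subseteq> - {0}"
    proof
      fix y assume "y \<in> closed_segment ?w (Complex (of_int d * C t) (S t))"
      then obtain s where s: "0 \<le> s" "s \<le> 1" "y = (1 - s) *\<^sub>R ?w + s *\<^sub>R Complex (of_int d * C t) (S t)"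
        by (auto simp: closed_segment_def)
      have Imy: "Im y = (1 - s) * Im ?w + s * S t" and Rey: "Re y = (1 - s) * Re ?w + s * (of_int d * C t)"
        using s(3) by simp_all
      have y0: "y \<noteq> 0" if "s = 0" using that wne s(3) by simp
      have img: "snd (F (p1 t)) \<in> {0..1}"
        using F(3) p1s[of t] by (force simp: strip_def)
      \<comment> \<open>In the first two cases the imaginary parts of both ends have the same weak sign, strict at
        the far end; in the third case the real parts have the same strict sign.\<close>
      consider "S t \<ge> 1/2" | "S t \<le> -1/2" | "\<bar>S t\<bar> < 1/2" by linarith
      then have "y \<noteq> 0"
      proof cases
        case 1
        then have "q1 t = (0, 0)" by (simp add: q1_def c_def)
        then have "Im ?w \<ge> 0" using img by (simp add: difference_map_def bdry)
        moreover have "s * S t > 0" if "s \<noteq> 0" using that 1 s(1) by simp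
        ultimately have "Im y > 0" if "s \<noteq> 0"
          using that s(2) unfolding Imy by (intro add_nonneg_pos) auto
        then show ?thesis using y0 by (cases "s = 0") auto
      next
        case 2
        then have "q1 t = (0, 1)" by (simp add: q1_def c_def)
        then have "Im ?w \<le> 0" using img by (simp add: difference_map_def bdry)
        moreover have "s * S t < 0" if "s \<noteq> 0" using that 2 s(1) by (simp add: mult_less_0_iff)
        ultimately have "Im y < 0" if "s \<noteq> 0"
          using that s(2) unfolding Imy by (intro add_nonpos_neg) (auto simp: mult_le_0_iff)
        then show ?thesis using y0 by (cases "s = 0") auto
      next
        case 3
        then have "(S t)\<^sup>2 < (1/2)\<^sup>2" by (metis abs_square_less_1 power2_abs power2_less_imp_less power_strict_mono abs_ge_zero zero_less_numeral)
        then have "(C t)\<^sup>2 > (1/2)\<^sup>2" using sq[of t] by (simp add: power2_eq_square)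
        then have C: "\<bar>C t\<bar> > 1/2" by (metis abs_ge_zero power2_abs power2_less_imp_less)
        define n :: int where "n = (if C t > 0 then 1 else -1)"
        have "p1 t = q1 t + (of_int n, 0)"
          using 3 C by (auto simp: p1_def q1_def c_def e_def n_def abs_if split: if_splits)
        then have w: "Re ?w = of_int (n * d)"
          using deg[OF p1s(2)] by (simp add: difference_map_def)
        have "Re y = of_int d * ((1 - s) * of_int n + s * C t)"
          unfolding Rey w by (simp add: algebra_simps)
        moreover have "(1 - s) * of_int n + s * C t \<noteq> 0"
        proof (cases "C t > 0")
          case True
          then have "(1 - s) * 1 + s * C t > 0"
            using s C by (cases "s = 0") (auto intro!: add_nonneg_pos)
          then show ?thesis using True by (simp add: n_def)
        next
          case False
          then have "s * C t < 0" if "s \<noteq> 0"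
            using that s(1) C by (auto simp: mult_less_0_iff)
          then have "- (1 - s) + s * C t < 0"
            using s(2) by (cases "s = 0") auto
          then show ?thesis using False by (simp add: n_def)
        qed
        ultimately have "Re y \<noteq> 0" using d by auto
        then show ?thesis by auto
      qed
      then show "y \<in> - {0}" by simp
    qed
  qed
  have circ: "circlepath w r t = w + of_real r * Complex (C t) (S t)" for w r t
  proof -
    have "exp (2 * of_real pi * \<i> * of_real t) = cis (2 * pi * t)"
      by (simp add: cis_conv_exp ac_simps)
    then show ?thesis by (simp add: circlepath complex_eq_iff C_def S_def)
  qed
  have "winding_number (\<lambda>t. Complex (of_int d * C t) (S t)) 0 = of_int d"
  proof -
    have unit: "winding_number (circlepath 0 1) 0 = 1"
      by (rule winding_number_circlepath_centre) simp
    have notin: "0 \<notin> path_image (circlepath 0 1)" by simp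
    show ?thesis
    proof (cases "d = 1")
      case True
      then have "(\<lambda>t. Complex (of_int d * C t) (S t)) = circlepath 0 1"
        by (auto simp: circ)
      then show ?thesis using unit True by simp
    next
      case False
      with d have "d = -1" by simp
      then have "(\<lambda>t. Complex (of_int d * C t) (S t)) = cnj \<circ> (uminus \<circ> circlepath 0 1)"
        by (auto simp: circ complex_eq_iff)
      moreover have "winding_number (cnj \<circ> (uminus \<circ> circlepath 0 1)) (cnj 0)
          = - cnj (winding_number (uminus \<circ> circlepath 0 1) 0)"
        using notin by (intro winding_number_cnj path_continuous_image)
          (auto intro!: continuous_intros simp: path_image_compose)
      moreover have "winding_number (uminus \<circ> circlepath 0 1) 0 = 1"
        using winding_number_negatepath[OF _ notin] unit by simp
      ultimately show ?thesis using \<open>d = -1\<close> by simp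
    qed
  qed
  moreover have "winding_number (\<lambda>t. difference_map F (p0 t) (q0 t)) 0
      = winding_number (\<lambda>t. Complex (of_int d * C t) (S t)) 0"
    by (rule winding_number_homotopic_loops[OF homotopic_loops_trans[OF hom1 hom2]])
  moreover have "winding_number (on_plane F \<circ> circlepath z (1/4)) (on_plane F z)
      = winding_number (\<lambda>t. difference_map F (p0 t) (q0 t)) 0"
  proof -
    have "(on_plane F \<circ> circlepath z (1/4)) t - on_plane F z = difference_map F (p0 t) (q0 t)" for t
      by (simp add: circ on_plane_def difference_map_def p0_def q0_def z_def complex_eq_iff)
    then show ?thesis by (subst winding_number_offset) simp
  qed
  ultimately show ?thesis by simp
qed

section \<open>Recurrence of iterates\<close>

lemma continuous_on_iterate:
  fixes f :: "'a::topological_space \<Rightarrow> 'a"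
  assumes f: "continuous_on S f" "f ` S \<subseteq> S"
  shows "continuous_on S (f ^^ n) \<and> (f ^^ n) ` S \<subseteq> S"
proof (induction n)
  case (Suc n)
  then have "continuous_on S (\<lambda>u. f ((f ^^ n) u))"
    by (intro continuous_on_compose2[OF f(1)]) auto
  then show ?case using Suc f(2) by (auto simp: comp_def)
qed auto

text \<open>Returning to smaller and smaller open subsets of \<open>U\<close> yields a point that visits \<open>U\<close> at
  arbitrarily many times. Two of them agree modulo \<open>q\<close>, and the orbit from the earlier to
  the later visit is a return under the \<open>q\<close>-th iterate.\<close>

lemma non_wandering_iterate_returns:
  assumes nw: "non_wandering f" and f: "continuous_on annulus f" "f ` annulus \<subseteq> annulus"
    and U: "openin (top_of_set annulus) U" "U \<noteq> {}" and q: "q > 0"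
  obtains u n where "u \<in> U" "n > 0" "(f ^^ (q * n)) u \<in> U"
proof -
  note fn = continuous_on_iterate[OF f]
  have returns: "\<exists>W T. openin (top_of_set annulus) W \<and> W \<noteq> {} \<and> W \<subseteq> U \<and> finite T \<and> card T = m \<and>
      (\<forall>u\<in>W. \<forall>t\<in>T. (f ^^ t) u \<in> U)" for m
  proof (induction m)
    case 0
    show ?case using U by (intro exI[of _ U] exI[of _ "{}"]) auto
  next
    case (Suc m)
    then obtain W T where W: "openin (top_of_set annulus) W" "W \<noteq> {}" "W \<subseteq> U"
      and T: "finite T" "card T = m" "\<And>u t. u \<in> W \<Longrightarrow> t \<in> T \<Longrightarrow> (f ^^ t) u \<in> U" by blast
    obtain w where w: "w \<in> W" using W(2) by blast
    then have "\<not> wandering f w"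
      using nw openin_imp_subset[OF W(1)] by (auto simp: non_wandering_def)
    then obtain n where n: "n \<ge> 1" "(f ^^ n) ` W \<inter> W \<noteq> {}"
      using W(1) w unfolding wandering_def by blast
    \<comment> \<open>Points of \<open>W'\<close> inherit the visits of their \<open>n\<close>-th image, and lie in \<open>U\<close> at time \<open>0\<close>.\<close>
    define W' where "W' = W \<inter> (annulus \<inter> (f ^^ n) -` W)"
    define T' where "T' = insert 0 ((+) n ` T)"
    have "openin (top_of_set annulus) W'"
      unfolding W'_def using fn[of n] W(1)
      by (intro openin_Int continuous_openin_preimage[of _ _ annulus]) auto
    moreover have "W' \<noteq> {}"
      using n(2) openin_imp_subset[OF W(1)] by (auto simp: W'_def)
    moreover have "W' \<subseteq> U" using W(3) by (auto simp: W'_def)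
    moreover have "finite T'" "card T' = Suc m"
      using T(1,2) n(1) by (auto simp: T'_def card_insert_if card_image)
    moreover have "(f ^^ t) u \<in> U" if uW: "u \<in> W'" and tT: "t \<in> T'" for u t
    proof (cases "t = 0")
      case True
      then show ?thesis using uW W(3) by (auto simp: W'_def)
    next
      case False
      then obtain s where s: "s \<in> T" "t = s + n" using tT by (auto simp: T'_def)
      have "(f ^^ n) u \<in> W" using uW by (simp add: W'_def)
      from T(3)[OF this s(1)] show ?thesis by (simp add: s(2) funpow_add)
    qed
    ultimately show ?case by blast
  qed
  obtain W T where W: "W \<noteq> {}" and T: "finite T" "card T = Suc q"
    "\<And>u t. u \<in> W \<Longrightarrow> t \<in> T \<Longrightarrow> (f ^^ t) u \<in> U" using returns[of "Suc q"] by blast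
  have "\<not> inj_on (\<lambda>t. t mod q) T"
  proof
    assume "inj_on (\<lambda>t. t mod q) T"
    then have "card T \<le> card {..<q}" by (rule card_inj_on_le) (use q in auto)
    with T(2) show False by simp
  qed
  then obtain s t where st: "s \<in> T" "t \<in> T" "s < t" "s mod q = t mod q"
    unfolding inj_on_def by (metis linorder_neqE_nat)
  then obtain n where n: "t = q * n + s"
    by (metis add.commute less_imp_le_nat mod_eq_nat1E)
  obtain u where u: "u \<in> W" using W by blast
  have "(f ^^ s) u \<in> U" "(f ^^ (q * n)) ((f ^^ s) u) \<in> U" "n > 0"
    using T(3)[OF u st(1)] T(3)[OF u st(2)] st(3) by (auto simp: n funpow_add intro: gr0I)
  then show ?thesis using that by blast
qed

section \<open>Trapped rectangles\<close>

text \<open>On a boundary line \<open>F\<close> is an injective continuous real function, hence monotone, and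
  commuting with the unit translation makes it increasing.\<close>

lemma degree_one_lift_boundary:
  assumes F: "continuous_on strip F" "inj_on F strip"
    and deg: "\<And>p. p \<in> strip \<Longrightarrow> F (p + (1, 0)) = F p + (1, 0)"
    and i: "i \<in> {0..1}" and bdry: "\<And>x. snd (F (x, i)) = i"
  shows "degree_one_lift (boundary_map F i)"
proof
  let ?h = "boundary_map F i"
  have st: "(x, i) \<in> strip" for x using i by (simp add: strip_def)
  show cont: "continuous_on UNIV ?h"
    unfolding boundary_map_def
    by (intro continuous_intros continuous_on_compose2[OF F(1)]) (use st in auto)
  show sh: "?h (x + 1) = ?h x + 1" for x
    using deg[OF st[of x]] by (simp add: boundary_map_def)
  have inj: "inj ?h"
  proof (rule injI)
    fix x y assume "?h x = ?h y"
    then have "F (x, i) = F (y, i)" by (simp add: boundary_map_def bdry prod_eq_iff)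
    then show "x = y" using inj_onD[OF F(2)] st by blast
  qed
  have shn: "?h (x + real n) = ?h x + real n" for x n
  proof (induction n)
    case (Suc n)
    then show ?case using sh[of "x + real n"] by (simp add: ac_simps)
  qed simp
  show "strict_mono ?h"
  proof (rule strict_monoI)
    fix x y :: real assume "x < y"
    obtain n where n: "y - x < real n" using reals_Archimedean2 by blast
    have "(?h x < ?h y \<and> ?h y < ?h (x + real n)) \<or> (?h (x + real n) < ?h y \<and> ?h y < ?h x)"
      by (rule continuous_inj_imp_mono[OF \<open>x < y\<close>])
        (use n in \<open>auto intro: continuous_on_subset[OF cont] inj_on_subset[OF inj]\<close>)
    then show "?h x < ?h y" using shn[of x n] by auto
  qed
qed

text \<open>What the trapping argument uses of a lift: the twist puts the image of each vertical fiber
  between the images of its ends, and monotonicity of the boundary maps propagates these bounds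
  along orbits.\<close>

locale twist_lift =
  fixes F :: "real \<times> real \<Rightarrow> real \<times> real"
  assumes maps: "p \<in> strip \<Longrightarrow> F p \<in> strip"
    and bottom: "snd (F (x, 0)) = 0" and top: "snd (F (x, 1)) = 1"
    and lower: "degree_one_lift (boundary_map F 0)"
    and upper: "degree_one_lift (boundary_map F 1)"
    and twist: "strict_mono_on {0..1} (\<lambda>y. fst (F (x, y)))"
begin

abbreviation "h0 \<equiv> boundary_map F 0"
abbreviation "h1 \<equiv> boundary_map F 1"

lemma boundary_less: "h0 x < h1 x"
  using strict_mono_onD[OF twist, of 0 1] by (simp add: boundary_map_def)

lemma iterate_maps: "p \<in> strip \<Longrightarrow> (F ^^ n) p \<in> strip"
  by (induction n) (auto intro: maps)

lemma iterate_bounds: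
  assumes "p \<in> strip"
  shows "(h0 ^^ n) (fst p) \<le> fst ((F ^^ n) p)" "fst ((F ^^ n) p) \<le> (h1 ^^ n) (fst p)"
proof -
  interpret L: degree_one_lift h0 by (rule lower)
  interpret U: degree_one_lift h1 by (rule upper)
  have step: "h0 (fst r) \<le> fst (F r)" "fst (F r) \<le> h1 (fst r)" if "r \<in> strip" for r
    using that strict_mono_on_leD[OF twist[of "fst r"], of 0 "snd r"]
      strict_mono_on_leD[OF twist[of "fst r"], of "snd r" 1]
    by (auto simp: boundary_map_def strip_def)
  show "(h0 ^^ n) (fst p) \<le> fst ((F ^^ n) p)"
  proof (induction n)
    case (Suc n)
    then have "h0 ((h0 ^^ n) (fst p)) \<le> h0 (fst ((F ^^ n) p))" by (simp only: L.le_iff)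
    then show ?case using step(1)[OF iterate_maps[OF assms, of n]] by simp
  qed simp
  show "fst ((F ^^ n) p) \<le> (h1 ^^ n) (fst p)"
  proof (induction n)
    case (Suc n)
    then have "h1 (fst ((F ^^ n) p)) \<le> h1 ((h1 ^^ n) (fst p))" by (simp only: U.le_iff)
    then show ?case using step(2)[OF iterate_maps[OF assms, of n]] by simp
  qed simp
qed

lemma iterate_bottom: "(F ^^ n) (x, 0) = ((h0 ^^ n) x, 0)"
proof -
  have "F (x, 0) = (h0 x, 0)" for x
    by (simp add: boundary_map_def prod_eq_iff bottom)
  then show ?thesis by (induction n) auto
qed

lemma rectangle_trapped:
  assumes "(h0 ^^ q) a = a + c" "(h1 ^^ q) b = b + c" and p: "p \<in> {a..b} \<times> {0..1}"
  shows "(F ^^ q) p \<in> {a + c..b + c} \<times> {0..1}"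
proof -
  interpret L: degree_one_lift "h0 ^^ q" by (rule degree_one_lift.iterate[OF lower])
  interpret U: degree_one_lift "h1 ^^ q" by (rule degree_one_lift.iterate[OF upper])
  have ps: "p \<in> strip" using p by (auto simp: strip_def)
  have "(h0 ^^ q) a \<le> (h0 ^^ q) (fst p)" "(h1 ^^ q) (fst p) \<le> (h1 ^^ q) b"
    using p by (auto simp: L.le_iff U.le_iff)
  then show ?thesis
    using iterate_bounds[OF ps, of q] iterate_maps[OF ps, of q] assms
    by (auto simp: mem_Times_iff strip_def)
qed

text \<open>The left side can only be reached along the bottom: from a point with positive height the twist gives a
  strict gain in the first step, which the increasing lower boundary map never loses.\<close>

lemma top_left_corner_avoided:
  assumes "q > 0" and "(h0 ^^ q) a = a + c" and p: "p \<in> {a..b} \<times> {0..1}"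
  shows "(F ^^ q) p \<noteq> (a + c, 1)"
proof
  assume eq: "(F ^^ q) p = (a + c, 1)"
  obtain n where n: "q = Suc n" using assms(1) gr0_implies_Suc by blast
  interpret L: degree_one_lift h0 by (rule lower)
  interpret Ln: degree_one_lift "h0 ^^ n" by (rule L.iterate)
  have ps: "p \<in> strip" using p by (auto simp: strip_def)
  show False
  proof (cases "snd p = 0")
    case True
    then have "(F ^^ q) p = ((h0 ^^ q) (fst p), 0)" using iterate_bottom[of q "fst p"] by (cases p) simp
    with eq show False by simp
  next
    case False
    have "h0 a \<le> h0 (fst p)" using p by (auto simp: L.le_iff)
    also have "\<dots> < fst (F p)"
      using strict_mono_onD[OF twist, of 0 "snd p" "fst p"] p False
      by (auto simp: boundary_map_def)
    finally have "(h0 ^^ n) (h0 a) < (h0 ^^ n) (fst (F p))" by (simp only: Ln.less_iff)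
    also have "\<dots> \<le> fst ((F ^^ n) (F p))" by (rule iterate_bounds(1)[OF maps[OF ps]])
    finally have "(h0 ^^ q) a < fst ((F ^^ q) p)" by (simp add: n funpow_swap1)
    with eq assms(2) show False by simp
  qed
qed

end

text \<open>The rectangle over \<open>{a..b}\<close> is mapped into a translate of itself, missing its top left corner.
  Near that corner there is an open subset of the annulus inside the projected rectangle but outside its image,
  which orbits of the \<open>q\<close>-th iterate leave forever. Since \<open>b - a < 1\<close>, the translates of the
  rectangle do not interfere; removing \<open>E\<close>, the part over \<open>{b..a + 1}\<close>, keeps \<open>U\<close> over
  the open interval from \<open>a\<close> to \<open>b\<close>.\<close>

lemma trapped_annular_region:
  assumes tw: "twist_lift F" and lift: "is_lift f F"
    and q: "q > 0" "(boundary_map F 0 ^^ q) a = a + of_int p" "(boundary_map F 1 ^^ q) b = b + of_int p"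
    and ab: "a < b" "b < a + 1"
    and f: "continuous_on annulus f" "f ` annulus \<subseteq> annulus"
  obtains U where "openin (top_of_set annulus) U" "U \<noteq> {}"
    "\<And>u n. u \<in> U \<Longrightarrow> n > 0 \<Longrightarrow> (f ^^ (q * n)) u \<notin> U"
proof -
  interpret twist_lift F by fact
  define D where "D = {a..b} \<times> {0..1::real}"
  define S where "S = cover ` D"
  define C where "C = (f ^^ q) ` S"
  define E where "E = cover ` ({b..a + 1} \<times> {0..1::real})"
  define U where "U = annulus - (C \<union> E)"
  have D: "D \<subseteq> strip" by (auto simp: D_def strip_def)
  have SA: "S \<subseteq> annulus" using D cover_in_annulus by (auto simp: S_def)
  have conj: "(f ^^ n) (cover r) = cover ((F ^^ n) r)" if "r \<in> strip" for n r
    using iterate_maps[OF that] lift by (induction n) (auto simp: is_lift_def)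
  note fn = continuous_on_iterate[OF f]
  have C_eq: "C = (\<lambda>r. cover ((F ^^ q) r)) ` D"
    unfolding C_def S_def image_image using D conj by (intro image_cong) auto
  have CS: "C \<subseteq> S"
  proof
    fix u assume "u \<in> C"
    then obtain r where r: "r \<in> D" "u = cover ((F ^^ q) r)"
      unfolding C_eq image_iff by blast
    let ?s = "(F ^^ q) r - (of_int p, 0)"
    have "?s \<in> D" using rectangle_trapped[OF q(2,3), of r] r(1) by (auto simp: D_def)
    moreover have "cover ?s = u"
      unfolding r(2) cover_eq_iff by (intro exI[of _ "-p"]) simp
    ultimately show "u \<in> S" by (auto simp: S_def)
  qed
  have "compact S"
    unfolding S_def D_def
    by (intro compact_continuous_image continuous_on_cover compact_Times compact_Icc)
  then have "compact C"
    unfolding C_def using fn[of q] SA continuous_on_subset by (intro compact_continuous_image) auto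
  moreover have "compact E"
    unfolding E_def
    by (intro compact_continuous_image continuous_on_cover compact_Times compact_Icc)
  ultimately have closed: "closed C" "closed E" by (auto intro: compact_imp_closed)
  have "openin (top_of_set annulus) U"
  proof -
    have "U = annulus \<inter> - (C \<union> E)" by (auto simp: U_def)
    then show ?thesis using closed by (simp only: openin_open_Int open_Compl closed_Un)
  qed
  moreover have "U \<noteq> {}"
  proof
    assume "U = {}"
    \<comment> \<open>If \<open>U\<close> were empty, the whole top edge would lie in the closed set \<open>C\<close>, corner included.\<close>
    have inC: "cover (x, 1) \<in> C" if x: "x \<in> {a<..<b}" for x
    proof -
      have "cover (x, 1) \<notin> E"
      proof
        assume "cover (x, 1) \<in> E"
        then obtain r where "r \<in> {b..a + 1} \<times> {0..1}" "cover (x, 1) = cover r"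
          unfolding E_def by blast
        then obtain k :: int where "r \<in> {b..a + 1} \<times> {0..1}" "(x, 1) = r + (of_int k, 0)"
          unfolding cover_eq_iff by blast
        then have "b + of_int k \<le> x" "x \<le> a + 1 + of_int k" by auto
        then have "real_of_int k < real_of_int 0" "real_of_int (-1) < real_of_int k" using x by auto
        then show False unfolding of_int_less_iff by simp
      qed
      moreover have "cover (x, 1) \<in> annulus" by (rule cover_in_annulus) (simp add: strip_def)
      ultimately show ?thesis using \<open>U = {}\<close> by (auto simp: U_def)
    qed
    have "continuous_on UNIV (\<lambda>x. cover (x, 1))"
      unfolding cover_def cis_conv_exp by (intro continuous_intros)
    then have "closed ((\<lambda>x. cover (x, 1)) -` C)"
      by (rule closed_vimage[OF closed(1)])
    moreover have "{a<..<b} \<subseteq> (\<lambda>x. cover (x, 1)) -` C" using inC by auto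
    ultimately have "closure {a<..<b} \<subseteq> (\<lambda>x. cover (x, 1)) -` C" by (metis closure_minimal)
    then have "a \<in> (\<lambda>x. cover (x, 1)) -` C" 
      by (rule subsetD) (use ab(1) in \<open>simp add: closure_greaterThanLessThan\<close>)
    then have "cover (a, 1) \<in> C" by simp
    then obtain r where r: "r \<in> D" "cover (a, 1) = cover ((F ^^ q) r)"
      unfolding C_eq image_iff by blast
    then obtain k :: int where k: "(a, 1) = (F ^^ q) r + (of_int k, 0)"
      by (auto simp: cover_eq_iff)
    then have "fst ((F ^^ q) r) = a - of_int k" "snd ((F ^^ q) r) = 1"
      by (auto simp: prod_eq_iff)
    moreover have "fst ((F ^^ q) r) \<in> {a + of_int p..b + of_int p}"
      using rectangle_trapped[OF q(2,3), of r] r(1) by (auto simp: D_def)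
    ultimately have "real_of_int 0 \<le> real_of_int (- k - p)" "real_of_int (- k - p) < real_of_int 1"
      using ab by auto
    then have "k = - p" unfolding of_int_less_iff of_int_le_iff by simp
    then have "(F ^^ q) r = (a + of_int p, 1)" using k by (auto simp: prod_eq_iff)
    with top_left_corner_avoided[OF q(1,2)] r(1) show False by (auto simp: D_def)
  qed
  moreover have "(f ^^ (q * n)) u \<notin> U" if u: "u \<in> U" and n: "n > 0" for u n
  proof -
    obtain r where r: "r \<in> strip" "cover r = u" "a \<le> fst r" "fst r < a + 1"
      using annulus_cover[of u a] u by (auto simp: U_def)
    have "fst r < b"
    proof (rule ccontr)
      assume "\<not> fst r < b"
      then have "r \<in> {b..a + 1} \<times> {0..1}" using r by (auto simp: strip_def mem_Times_iff)
      then have "u \<in> E" using r(2) by (auto simp: E_def)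
      with u show False by (simp add: U_def)
    qed
    then have "u \<in> S" using r by (auto simp: S_def D_def strip_def mem_Times_iff intro!: image_eqI[of _ _ r])
    then have "(f ^^ (q * Suc m)) u \<in> C" for m
    proof (induction m)
      case (Suc m)
      then have "(f ^^ q) ((f ^^ (q * Suc m)) u) \<in> C" using CS by (auto simp: C_def)
      moreover have "q * Suc (Suc m) = q + q * Suc m" by simp
      ultimately show ?case by (simp only: funpow_add comp_apply)
    qed (simp add: C_def)
    then show ?thesis using n gr0_implies_Suc[OF n] by (auto simp: U_def)
  qed
  ultimately show ?thesis using that by blast
qed

section \<open>Boundary rotation numbers of non-wandering twist maps\<close>

theorem theorem1p1:
  fixes f :: "complex \<times> real \<Rightarrow> complex \<times> real"
    and F :: "real \<times> real \<Rightarrow> real \<times> real"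
  assumes "twist_map f"
    and "non_wandering f"
    and "is_lift f F"
  shows "rotation_number (boundary_map F 0) < rotation_number (boundary_map F 1)"
proof (rule ccontr)
  assume not_less: "\<not> ?thesis"
  obtain g where hom: "homeomorphism annulus annulus f g"
    using assms(1) by (auto simp: twist_map_def)
  then have f: "continuous_on annulus f" "f ` annulus \<subseteq> annulus"
    by (auto simp: homeomorphism_def)
  have F: "continuous_on strip F" "F ` strip \<subseteq> strip"
    "\<And>p. p \<in> strip \<Longrightarrow> cover (F p) = f (cover p)"
    using assms(3) by (auto simp: is_lift_def)
  obtain d :: int where d: "d = 1 \<or> d = -1" and inj: "inj_on F strip"
    and deg: "\<And>p n. p \<in> strip \<Longrightarrow> F (p + (of_int n, 0)) = F p + (of_int (n * d), 0)"
    using homeomorphism_lift[OF hom assms(3)] by blast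
  have bdry: "snd (F (x, 0)) = 0" "snd (F (x, 1)) = 1" for x
  proof -
    have "snd (F (x, i)) = snd (f (cover (x, i)))" if "i \<in> {0..1}" for i
    proof -
      have "(x, i) \<in> strip" using that by (simp add: strip_def)
      then show ?thesis using F(3)[of "(x, i)"] by (metis cover_def snd_conv)
    qed
    moreover have "cis (2 * pi * x) \<in> circle" by (simp add: circle_def)
    ultimately show "snd (F (x, 0)) = 0" "snd (F (x, 1)) = 1"
      using assms(1) by (auto simp: twist_map_def cover_def)
  qed
  define z where "z = Complex 0 (1/2)"
  have "cball z (1/4) \<subseteq> {w. 0 < Im w \<and> Im w < 1}"
  proof
    fix w assume "w \<in> cball z (1/4)"
    then have "\<bar>Im z - Im w\<bar> \<le> 1/4"
      using abs_Im_le_cmod[of "z - w"] by (auto simp: dist_norm)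
    then show "w \<in> {w. 0 < Im w \<and> Im w < 1}" by (auto simp: z_def abs_if split: if_splits)
  qed
  then have "winding_number (on_plane F \<circ> circlepath z (1/4)) (on_plane F z) = 1"
    using assms(1,3) unfolding twist_map_def orientation_preserving_def local_degree_one_on_def by simp
  moreover have "winding_number (on_plane F \<circ> circlepath z (1/4)) (on_plane F z) = of_int d"
    unfolding z_def by (rule winding_number_circle_eq_degree[OF F(1) inj F(2) bdry deg d])
  ultimately have "d = 1" by (metis of_int_eq_1_iff)
  then have deg1: "F (p + (1, 0)) = F p + (1, 0)" if "p \<in> strip" for p
    using deg[OF that, of 1] by simp
  have tw: "twist_lift F"
  proof (rule twist_lift.intro)
    show "degree_one_lift (boundary_map F 0)" "degree_one_lift (boundary_map F 1)"
      using degree_one_lift_boundary[OF F(1) inj deg1] bdry by simp_all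
    show "strict_mono_on {0..1} (\<lambda>y. fst (F (x, y)))" for x
      using assms(1,3) by (auto simp: twist_map_def twist_condition_def)
    show "F p \<in> strip" if "p \<in> strip" for p using F(2) that by blast
  qed (rule bdry)+
  interpret twist_lift F by (rule tw)
  have rot: "rotation_number h1 \<le> rotation_number h0" using not_less by simp
  obtain q p a b where qp: "q > 0" "(h0 ^^ q) a = a + of_int p" "(h1 ^^ q) b = b + of_int p"
    and ab: "a < b" "b < a + 1"
    by (rule common_periodic_orbits[OF lower upper boundary_less rot])
  obtain U where U: "openin (top_of_set annulus) U" "U \<noteq> {}"
    "\<And>u n. u \<in> U \<Longrightarrow> n > 0 \<Longrightarrow> (f ^^ (q * n)) u \<notin> U"
    using trapped_annular_region[OF tw assms(3) qp ab f] by blast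
  obtain u n where "u \<in> U" "n > 0" "(f ^^ (q * n)) u \<in> U"
    using non_wandering_iterate_returns[OF assms(2) f U(1,2) qp(1)] by blast
  with U(3) show False by blast
qed

end
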